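(* Fix $\epsilon>0$, $q\in[0,1]$, and $\delta_1,\dots,\delta_p\ge0$. Define the set of null variables $\breve{\mathcal H}_0=\{i:|\beta_i|\le\delta_i\}$, and let $\Delta=(\Delta_1,\dots,\Delta_{2p})^\top$, where $\Delta_1,\dots,\Delta_{2p}$ are independent random variables (independent of $\mathbf y$) with $$\Delta_j\sim\mathrm{Lap}\big(2\,s_{j\,(\mathsf{mod}\,p)}\,\delta_{j\,(\mathsf{mod}\,p)}/\epsilon\big),\qquad 1\le j\le 2p,$$ where $s_i=1-\mathbf X_i^\top\tilde{\mathbf X}_i$, $1\le i\le p$. Then the knockoff procedure with target FDR $q/e^{\epsilon}$, using antisymmetric statistics based on any estimator of the form $\tilde{\boldsymbol\theta}=\mathcal E\big(\mathbf G,[\mathbf X\ \tilde{\mathbf X}]^\top\mathbf y+\Delta\big)$, controls the FDR at level $q$; that is, $\mathbb E\big(|\mathcal R\cap\breve{\mathcal H}_0|/(|\mathcal R|\vee1)\big)\le q$, where $\mathcal R$ is the set of selected variables.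
   Context: Model: $\mathbf y=\mathbf X\boldsymbol\beta+\mathbf w$ with $\mathbf w\sim\mathcal N(0,\sigma^2\mathbf I_n)$, $\sigma^2>0$, $\mathbf X=[\mathbf X_1,\dots,\mathbf X_p]\in\mathbb R^{n\times p}$ a fixed (deterministic) design with $n\ge 2p$, columns of Euclidean norm $1$, and $\boldsymbol\Sigma=\mathbf X^\top\mathbf X$ invertible; $\boldsymbol\beta=(\beta_1,\dots,\beta_p)^\top\in\mathbb R^p$ is a fixed unknown vector. Knockoff matrix: fix $\mathbf s=(s_1,\dots,s_p)\in\mathbb R^p_+$ with $\mathrm{diag}(\mathbf s)\preceq 2\boldsymbol\Sigma$, and let $\tilde{\mathbf X}=[\tilde{\mathbf X}_1,\dots,\tilde{\mathbf X}_p]=\mathbf X(\mathbf I_p-\boldsymbol\Sigma^{-1}\mathrm{diag}(\mathbf s))+\tilde{\mathbf U}\mathbf C$, where $\tilde{\mathbf U}\in\mathbb R^{n\times p}$ has orthonormal columns with $\tilde{\mathbf U}^\top\mathbf X=0$, and $\mathbf C^\top\mathbf C=2\,\mathrm{diag}(\mathbf s)-\mathrm{diag}(\mathbf s)\boldsymbol\Sigma^{-1}\mathrm{diag}(\mathbf s)$. Then $$\mathbf G=[\mathbf X\ \tilde{\mathbf X}]^\top[\mathbf X\ \tilde{\mathbf X}]=\begin{bmatrix}\boldsymbol\Sigma&\boldsymbol\Sigma-\mathrm{diag}(\mathbf s)\\ \boldsymbol\Sigma-\mathrm{diag}(\mathbf s)&\boldsymbol\Sigma\end{bmatrix},$$ so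 that $s_i=1-\mathbf X_i^\top\tilde{\mathbf X}_i$. Laplace noise: $\mathrm{Lap}(b)$ is the centered Laplace distribution with scale $b$ (density $\frac1{2b}e^{-|x|/b}$), understood as the point mass at $0$ when $b=0$. The index $j\,(\mathsf{mod}\,p)$ takes values in $\{1,\dots,p\}$, so $\Delta_i$ and $\Delta_{i+p}$ both have scale $2s_i\delta_i/\epsilon$. Estimators: $\mathcal E$ is a deterministic (measurable) map producing a vector in $\mathbb R^{2p}$, and is assumed swap-equivariant: $P_i\,\mathcal E(\mathbf G,\mathbf z)=\mathcal E(\mathbf G,P_i\mathbf z)$ for all $\mathbf z\in\mathbb R^{2p}$ and $1\le i\le p$, where $P_i$ is the permutation matrix swapping entries $i$ and $i+p$. Write $\tilde{\boldsymbol\theta}=(\hat\theta_1,\dots,\hat\theta_p,\hat\theta_1',\dots,\hat\theta_p')^\top$. Antisymmetric statistics: $(W_1,\dots,W_p)$ is a function of the estimator such that, for any $F\subseteq\{1,\dots,p\}$, swapping $\hat\theta_i$ and $\hat\theta_i'$ for all $i\in F$ has the effect of switching the signs of $W_i$, $i\in F$ (leaving the other $W_i$ unchanged). Knockoff procedure with target FDR $\tau$: given $W_1,\dots,W_p$, let $\Phi=\{|W_j|:1\le j\le p\}\setminus\{0\}$ and $$T=\inf\Big\{t\in\Phi:\frac{1+\#\{j:W_j\le -t\}}{\#\{j:W_j\ge t\}\vee 1}\le \tau\Big\}$$ (with $\inf\emptyset=+\infty$); the procedure selects $\mathcal R=\{j:W_j\ge T\}$. *)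

theory Defs
  imports "HOL-Probability.Probability"
begin

section \<open>Probability distributions\<close>

definition isotropic_normal :: "real \<Rightarrow> (real ^ 'n::finite) measure" where
  "isotropic_normal \<sigma> =
     density lborel (\<lambda>x. ennreal (exp (- (norm x)\<^sup>2 / (2 * \<sigma>\<^sup>2)) / sqrt (2 * pi * \<sigma>\<^sup>2) ^ CARD('n)))"

text \<open>The scale \<open>b\<close> is meant to be nonnegative; scale \<open>0\<close> is the point mass at \<open>0\<close>.\<close>

definition laplace :: "real \<Rightarrow> real measure" where
  "laplace b =
     (if b = 0 then return borel 0
      else density lborel (\<lambda>x. ennreal (exp (- \<bar>x\<bar> / b) / (2 * b))))"

text \<open>The library constant \<open>indep_var\<close> requires both random variables to have the same type.\<close>

definition indep_rv :: "'a measure \<Rightarrow> 'b measure \<Rightarrow> ('a \<Rightarrow> 'b) \<Rightarrow> 'c measure \<Rightarrow> ('a \<Rightarrow> 'c) \<Rightarrow> bool" where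
  "indep_rv M S X T Y \<longleftrightarrow>
     X \<in> measurable M S \<and> Y \<in> measurable M T \<and>
     prob_space.indep_set M (sets (vimage_algebra (space M) X S)) (sets (vimage_algebra (space M) Y T))"

section \<open>Knockoff matrices\<close>

definition diag_mat :: "real ^ 'p \<Rightarrow> real ^ 'p ^ 'p" where
  "diag_mat s = (\<chi> i j. if i = j then s $ i else 0)"

definition psd :: "real ^ 'p ^ 'p \<Rightarrow> bool" where
  "psd A \<longleftrightarrow> transpose A = A \<and> (\<forall>x. 0 \<le> x \<bullet> (A *v x))"

definition gram :: "real ^ 'q ^ 'n \<Rightarrow> real ^ 'q ^ 'q" where
  "gram A = transpose A ** A"

definition knockoff_matrix ::
  "real ^ 'p ^ 'n \<Rightarrow> real ^ 'p \<Rightarrow> real ^ 'p ^ 'n \<Rightarrow> bool" where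
  "knockoff_matrix X s Xt \<longleftrightarrow>
     (\<exists>(U :: real ^ 'p ^ 'n) (C :: real ^ 'p ^ 'p).
        transpose U ** U = mat 1 \<and> transpose U ** X = 0 \<and>
        transpose C ** C =
          2 *\<^sub>R diag_mat s - diag_mat s ** matrix_inv (gram X) ** diag_mat s \<and>
        Xt = X ** (mat 1 - matrix_inv (gram X) ** diag_mat s) + U ** C)"

text \<open>
  Vectors in dimension \<open>2p\<close> are indexed by the sum type \<open>'p + 'p\<close>: \<open>Inl i\<close> is position \<open>i\<close>
  and \<open>Inr i\<close> is position \<open>i + p\<close>.
\<close>

definition hcat :: "real ^ 'p ^ 'n \<Rightarrow> real ^ 'p ^ 'n \<Rightarrow> real ^ ('p::finite + 'p) ^ 'n" where
  "hcat A B = (\<chi> k j. case j of Inl i \<Rightarrow> A $ k $ i | Inr i \<Rightarrow> B $ k $ i)"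

fun base_index :: "'p + 'p \<Rightarrow> 'p" where
  "base_index (Inl i) = i"
| "base_index (Inr i) = i"

section \<open>Swaps, estimators and antisymmetric statistics\<close>

definition swap_matrix :: "'p::finite \<Rightarrow> real ^ ('p::finite + 'p) ^ ('p::finite + 'p)" where
  "swap_matrix i =
     (\<chi> a b. if b = Transposition.transpose (Inl i) (Inr i) a then 1 else 0)"

definition swap_equivariant ::
  "(real ^ ('p::finite + 'p) \<Rightarrow> real ^ ('p::finite + 'p)) \<Rightarrow> bool" where
  "swap_equivariant f \<longleftrightarrow> (\<forall>z i. swap_matrix i *v f z = f (swap_matrix i *v z))"

definition swap_on :: "'p::finite set \<Rightarrow> real ^ ('p::finite + 'p) \<Rightarrow> real ^ ('p::finite + 'p)" where
  "swap_on F \<theta> =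
     (\<chi> j. case j of
             Inl i \<Rightarrow> if i \<in> F then \<theta> $ Inr i else \<theta> $ Inl i
           | Inr i \<Rightarrow> if i \<in> F then \<theta> $ Inl i else \<theta> $ Inr i)"

definition antisymmetric_statistics :: "(real ^ ('p::finite + 'p) \<Rightarrow> real ^ 'p) \<Rightarrow> bool" where
  "antisymmetric_statistics W \<longleftrightarrow>
     (\<forall>F \<theta>. W (swap_on F \<theta>) = (\<chi> i. if i \<in> F then - (W \<theta> $ i) else W \<theta> $ i))"

section \<open>The knockoff selection procedure\<close>

text \<open>The threshold is extended-real valued, since the infimum of the empty set is \<open>\<infinity>\<close>.\<close>

definition knockoff_threshold :: "real \<Rightarrow> real ^ 'p \<Rightarrow> ereal" where
  "knockoff_threshold \<tau> W =
     Inf (ereal ` {t \<in> range (\<lambda>j. \<bar>W $ j\<bar>) - {0}.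
        (1 + real (card {j. W $ j \<le> - t})) / real (max (card {j. W $ j \<ge> t}) 1) \<le> \<tau>})"

definition knockoff_select :: "real \<Rightarrow> real ^ 'p \<Rightarrow> 'p set" where
  "knockoff_select \<tau> W = {j. knockoff_threshold \<tau> W \<le> ereal (W $ j)}"

definition fdp :: "'p set \<Rightarrow> 'p set \<Rightarrow> real" where
  "fdp R H = real (card (R \<inter> H)) / real (max (card R) 1)"

section \<open>Gram matrix of the augmented design\<close>

lemma transpose_gram: "transpose (gram X) = gram X"
  by (simp add: gram_def matrix_transpose_mul)

lemma transpose_diag_mat: "transpose (diag_mat s) = diag_mat s"
  by (simp add: diag_mat_def transpose_def vec_eq_iff)

lemma matrix_diff_ldistrib:
  fixes A :: "real ^ 'm ^ 'n" and B C :: "real ^ 'p ^ 'm"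
  shows "A ** (B - C) = A ** B - A ** C"
  by (simp add: matrix_matrix_mult_def vec_eq_iff right_diff_distrib sum_subtractf)

lemma matrix_mult_zero_left:
  fixes A :: "real ^ 'p ^ 'm"
  shows "(0 :: real ^ 'm ^ 'n) ** A = 0"
  by (simp add: matrix_matrix_mult_def vec_eq_iff)

lemma knockoff_matrix_cross_gram:
  fixes X Xt :: "real ^ 'p ^ 'n"
  assumes "invertible (gram X)" "knockoff_matrix X s Xt"
  shows "transpose X ** Xt = gram X - diag_mat s"
proof -
  obtain U :: "real ^ 'p ^ 'n" and C :: "real ^ 'p ^ 'p" where U: "transpose U ** X = 0"
    and Xt: "Xt = X ** (mat 1 - matrix_inv (gram X) ** diag_mat s) + U ** C"
    using assms(2) unfolding knockoff_matrix_def by blast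
  have UX: "transpose X ** U = 0"
  proof -
    have "transpose X ** U = transpose (transpose U ** X)"
      by (simp add: matrix_transpose_mul)
    also have "\<dots> = 0"
      unfolding U by (simp add: transpose_def vec_eq_iff)
    finally show ?thesis .
  qed
  have inv: "gram X ** matrix_inv (gram X) = mat 1"
    using assms(1) unfolding invertible_def matrix_inv_def by (rule someI2_ex) simp
  have "transpose X ** Xt =
      gram X ** (mat 1 - matrix_inv (gram X) ** diag_mat s) + (transpose X ** U) ** C"
    by (simp add: Xt gram_def matrix_add_ldistrib matrix_mul_assoc)
  also have "\<dots> = gram X - (gram X ** matrix_inv (gram X)) ** diag_mat s"
    by (simp add: UX matrix_diff_ldistrib matrix_mult_zero_left matrix_mul_assoc)
  finally show ?thesis
    by (simp add: inv)
qed

lemma knockoff_matrix_scale: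
  fixes X Xt :: "real ^ 'p ^ 'n"
  assumes "invertible (gram X)" "knockoff_matrix X s Xt" "norm (column i X) = 1"
  shows "s $ i = 1 - column i X \<bullet> column i Xt"
proof -
  have "(transpose X ** Xt) $ i $ i = column i X \<bullet> column i Xt"
    by (simp add: matrix_matrix_mult_def transpose_def column_def inner_vec_def)
  moreover have "gram X $ i $ i = column i X \<bullet> column i X"
    by (simp add: gram_def matrix_matrix_mult_def transpose_def column_def inner_vec_def)
  moreover have "column i X \<bullet> column i X = 1"
    using assms(3) by (simp add: dot_square_norm)
  ultimately show ?thesis
    using knockoff_matrix_cross_gram[OF assms(1,2)] by (simp add: diag_mat_def)
qed

end

theory Submission
  imports Defs
begin

text \<open>
  Put \<open>z = [X Xt]\<^sup>T y + \<Delta>\<close>. For a null variable \<open>i\<close>, the law of \<open>z\<close> is at most \<open>exp \<epsilon>\<close> times the law of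
  \<open>z\<close> with the entries \<open>i\<close> and \<open>i + p\<close> swapped. Indeed, the swap of \<open>[X Xt]\<^sup>T w\<close> is \<open>[X Xt]\<^sup>T Q w\<close>, where
  \<open>Q\<close> is the reflection along \<open>X\<^sub>i - Xt\<^sub>i\<close>, and \<open>Q w\<close> has the law of \<open>w\<close>; the swap of the mean
  \<open>[X Xt]\<^sup>T X \<beta>\<close> moves the two entries by \<open>s\<^sub>i \<beta>\<^sub>i\<close> in opposite directions, and absorbing each of these
  shifts in Laplace noise of scale \<open>2 s\<^sub>i \<delta>\<^sub>i / \<epsilon>\<close> costs a factor \<open>exp (\<epsilon> / 2)\<close>.

  The swap flips the sign of \<open>W\<^sub>i\<close> only, so the leave-one-out argument for robust knockoffs applies.
  Let \<open>T\<^sub>j\<close> be the threshold for \<open>W\<close> with \<open>W\<^sub>j\<close> replaced by its absolute value. The false discovery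
  proportion is at most \<open>\<tau>\<close> times the sum over the nulls \<open>j\<close> of
  \<open>1{W\<^sub>j \<ge> T\<^sub>j} / (1 + #{k \<noteq> j null. W\<^sub>k \<le> - T\<^sub>j})\<close>. In expectation, a sign flip of \<open>W\<^sub>j\<close> in each
  summand costs \<open>exp \<epsilon>\<close>, and after the flips the sum is at most \<open>1\<close>, because the \<open>T\<^sub>j\<close> with
  \<open>W\<^sub>j \<le> - T\<^sub>j\<close> all agree.
\<close>

section \<open>Leave-one-out bounds\<close>

definition flip_at :: "'p \<Rightarrow> real ^ 'p \<Rightarrow> real ^ 'p" where
  "flip_at j w = (\<chi> i. if i = j then - (w $ i) else w $ i)"

definition abs_at :: "'p \<Rightarrow> real ^ 'p \<Rightarrow> real ^ 'p" where
  "abs_at j w = (\<chi> i. if i = j then \<bar>w $ i\<bar> else w $ i)"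

text \<open>The threshold is computed from \<open>abs_at j w\<close>, so that it does not depend on the sign of \<open>w $ j\<close>.\<close>

definition loo_ratio :: "real \<Rightarrow> 'p set \<Rightarrow> 'p \<Rightarrow> real ^ 'p::finite \<Rightarrow> real" where
  "loo_ratio \<tau> H j w =
     (if knockoff_threshold \<tau> (abs_at j w) \<le> ereal (w $ j)
      then 1 / (1 + real (card {k \<in> H - {j}. ereal (w $ k) \<le> - knockoff_threshold \<tau> (abs_at j w)}))
      else 0)"

abbreviation fdp_estimate :: "real ^ 'p::finite \<Rightarrow> real \<Rightarrow> real" where
  "fdp_estimate w t \<equiv>
     (1 + real (card {j. w $ j \<le> - t})) / real (max (card {j. w $ j \<ge> t}) 1)"

lemma abs_at_flip_at: "abs_at j (flip_at j w) = abs_at j w"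
  by (simp add: abs_at_def flip_at_def vec_eq_iff)

lemma range_abs_abs_at: "range (\<lambda>i. \<bar>abs_at j w $ i\<bar>) = range (\<lambda>i. \<bar>w $ i\<bar>)"
  by (rule arg_cong[where f = range]) (auto simp: abs_at_def)

text \<open>The infimum runs over finitely many candidates, so a finite threshold is itself a
  candidate: it is positive, and the estimate at it is at most \<tau>.\<close>

lemma knockoff_threshold_cases:
  obtains (infinite) "knockoff_threshold \<tau> w = \<infinity>"
  | (finite) t where "knockoff_threshold \<tau> w = ereal t" "t > 0" "t \<in> range (\<lambda>j. \<bar>w $ j\<bar>)"
      "fdp_estimate w t \<le> \<tau>"
proof -
  define S where "S = {t \<in> range (\<lambda>j. \<bar>w $ j\<bar>) - {0}. fdp_estimate w t \<le> \<tau>}"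
  have T: "knockoff_threshold \<tau> w = Inf (ereal ` S)"
    by (simp add: knockoff_threshold_def S_def)
  have fin: "finite S"
    by (simp add: S_def)
  show ?thesis
  proof (cases "S = {}")
    case True
    then show ?thesis
      using T infinite by (simp add: top_ereal_def)
  next
    case False
    then have "Inf (ereal ` S) \<in> ereal ` S"
      using fin by (metis Min_Inf Min_in finite_imageI image_is_empty)
    then obtain t where "t \<in> S" "Inf (ereal ` S) = ereal t"
      by auto
    then show ?thesis
      by (intro finite[of t]) (auto simp: T S_def)
  qed
qed

lemma knockoff_threshold_le:
  assumes "t \<in> range (\<lambda>j. \<bar>w $ j\<bar>)" "t \<noteq> 0" "fdp_estimate w t \<le> \<tau>"
  shows "knockoff_threshold \<tau> w \<le> ereal t"
  unfolding knockoff_threshold_def using assms by (intro Inf_lower imageI) auto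

lemma loo_ratio_nonneg: "0 \<le> loo_ratio \<tau> H j w"
  by (simp add: loo_ratio_def)

text \<open>A selected \<open>j\<close> has \<open>w $ j > 0\<close>, hence
  \<open>abs_at j w = w\<close>, and its leave-one-out threshold is the actual one. All selected
  nulls therefore contribute the same ratio \<open>1 / N\<close>, and \<open>N\<close> is at most
  the numerator of the estimate at the threshold. Multiplying and dividing the proportion by
  \<open>N\<close> gives the bound.\<close>

lemma fdp_le_sum_loo_ratio:
  "fdp (knockoff_select \<tau> w) H \<le> \<tau> * (\<Sum>j\<in>H. loo_ratio \<tau> H j w)"
proof (cases \<tau> w rule: knockoff_threshold_cases)
  case infinite
  have "loo_ratio \<tau> H j w = 0" if "j \<in> H" for j
  proof (rule ccontr)
    assume "loo_ratio \<tau> H j w \<noteq> 0"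
    then have le: "knockoff_threshold \<tau> (abs_at j w) \<le> ereal (w $ j)"
      by (auto simp: loo_ratio_def split: if_splits)
    then have "w $ j > 0"
      by (cases \<tau> "abs_at j w" rule: knockoff_threshold_cases) auto
    then have "abs_at j w = w"
      by (auto simp: abs_at_def vec_eq_iff)
    with le infinite show False by simp
  qed
  with infinite show ?thesis
    by (simp add: fdp_def knockoff_select_def)
next
  case (finite t)
  define N where "N = 1 + real (card {k \<in> H. w $ k \<le> - t})"
  have sel: "knockoff_select \<tau> w = {j. t \<le> w $ j}"
    by (simp add: knockoff_select_def finite)
  have loo: "1 / N = loo_ratio \<tau> H j w" if "j \<in> H" "t \<le> w $ j" for j
  proof -
    have "w $ j > 0"
      using that finite(2) by simp
    then have [simp]: "abs_at j w = w"
      by (auto simp: abs_at_def vec_eq_iff)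
    have "{k \<in> H - {j}. w $ k \<le> - t} = {k \<in> H. w $ k \<le> - t}"
      using that finite(2) by force
    then show ?thesis
      using that by (simp add: loo_ratio_def finite(1) N_def)
  qed
  have N: "N > 0"
    by (simp add: N_def)
  have "real (card {j\<in>H. t \<le> w $ j}) / N = (\<Sum>j\<in>{j\<in>H. t \<le> w $ j}. loo_ratio \<tau> H j w)"
    using loo by (simp flip: loo)
  also have "\<dots> \<le> (\<Sum>j\<in>H. loo_ratio \<tau> H j w)"
    by (intro sum_mono2) (auto simp: loo_ratio_nonneg)
  finally have sum: "real (card {j\<in>H. t \<le> w $ j}) / N \<le> (\<Sum>j\<in>H. loo_ratio \<tau> H j w)" .
  have "N \<le> 1 + real (card {k. w $ k \<le> - t})"
    unfolding N_def by (auto intro!: card_mono)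
  then have "N / real (max (card {j. t \<le> w $ j}) 1) \<le> fdp_estimate w t"
    by (intro divide_right_mono) auto
  with finite have le: "N / real (max (card {j. t \<le> w $ j}) 1) \<le> \<tau>"
    by simp
  have "fdp (knockoff_select \<tau> w) H =
      (N / real (max (card {j. t \<le> w $ j}) 1)) * (real (card {j\<in>H. t \<le> w $ j}) / N)"
    using N by (simp add: fdp_def sel Collect_conj_eq Int_commute)
  \<comment> \<open>Monotonicity of the product needs \<tau> \<ge> 0, which follows from
    \<open>le\<close>, since its left side is nonnegative.\<close>
  also have "\<dots> \<le> \<tau> * (\<Sum>j\<in>H. loo_ratio \<tau> H j w)"
    using N order_trans[OF _ le, of 0] by (intro mult_mono le sum) auto
  finally show ?thesis .
qed

text \<open>At the smaller threshold \<open>t\<close>, both \<open>w $ j\<close> and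
  \<open>w $ k\<close> are at most \<open>- t\<close>. Taking the absolute value of either one moves
  one index from the lower count to the upper count, so the two modified vectors have the same
  estimate at \<open>t\<close>. Hence \<open>t\<close> is also a candidate for the threshold of
  \<open>abs_at k w\<close>.\<close>

lemma knockoff_threshold_abs_at_le:
  assumes "ereal (w $ j) \<le> - knockoff_threshold \<tau> (abs_at j w)"
    and "ereal (w $ k) \<le> - knockoff_threshold \<tau> (abs_at k w)"
    and le: "knockoff_threshold \<tau> (abs_at j w) \<le> knockoff_threshold \<tau> (abs_at k w)"
  shows "knockoff_threshold \<tau> (abs_at k w) \<le> knockoff_threshold \<tau> (abs_at j w)"
proof (cases \<tau> "abs_at j w" rule: knockoff_threshold_cases)
  case infinite
  then show ?thesis by simp
next
  case (finite t)
  have j: "w $ j \<le> - t"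
    using assms(1) finite by simp
  have "ereal (w $ k) \<le> - ereal t"
    using assms(2) le finite(1) by (metis ereal_minus_le_minus order_trans)
  then have k: "w $ k \<le> - t"
    by simp
  have "{i. abs_at i' w $ i \<le> - t} = {i. w $ i \<le> - t} - {i'}"
    "{i. t \<le> abs_at i' w $ i} = insert i' {i. t \<le> w $ i}" if "w $ i' \<le> - t" for i'
    using that finite(2) by (auto simp: abs_at_def split: if_splits)
  note sets = this[OF j] this[OF k]
  have "i' \<notin> {i. t \<le> w $ i}" "i' \<in> {i. w $ i \<le> - t}" if "w $ i' \<le> - t" for i'
    using that finite(2) by auto
  note mem = this[OF j] this[OF k]
  have "fdp_estimate (abs_at k w) t = fdp_estimate (abs_at j w) t"
    using mem by (simp add: sets card_Diff_singleton)
  then show ?thesis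
    unfolding finite(1) using finite
    by (intro knockoff_threshold_le) (auto simp: range_abs_abs_at)
qed

text \<open>After the flip, a summand is nonzero only for \<open>j\<close> in \<open>S\<close>. The
  thresholds agree on \<open>S\<close>, so the count in the denominator for \<open>j\<close>
  includes all of \<open>S - {j}\<close>, and the summand is at most
  \<open>1 / card S\<close>.\<close>

lemma sum_loo_ratio_flip_at_le:
  "(\<Sum>j\<in>H. loo_ratio \<tau> H j (flip_at j w)) \<le> 1"
proof -
  let ?T = "\<lambda>j. knockoff_threshold \<tau> (abs_at j w)"
  define S where "S = {j\<in>H. ereal (w $ j) \<le> - ?T j}"
  have eq: "?T j = ?T k" if "j \<in> S" "k \<in> S" for j k
    using knockoff_threshold_abs_at_le[of w j \<tau> k] knockoff_threshold_abs_at_le[of w k \<tau> j] that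
    by (intro antisym) (metis (mono_tags, lifting) S_def linear mem_Collect_eq)+
  have neg: "?T j \<le> ereal (- x) \<longleftrightarrow> ereal x \<le> - ?T j" for j x
    by (metis ereal_minus_le_minus ereal_uminus_uminus uminus_ereal.simps(1))
  have "loo_ratio \<tau> H j (flip_at j w) \<le> (if j \<in> S then 1 / real (card S) else 0)" if "j \<in> H" for j
  proof (cases "j \<in> S")
    case True
    let ?B = "{k \<in> H - {j}. ereal (flip_at j w $ k) \<le> - ?T j}"
    have "S - {j} \<subseteq> ?B"
      using eq[OF True] by (auto simp: S_def flip_at_def)
    then have "card (S - {j}) \<le> card ?B"
      by (intro card_mono) auto
    then have "card S \<le> 1 + card ?B" "card S > 0"
      using True by (auto simp: card_gt_0_iff)
    then show ?thesis
      using True by (auto simp: loo_ratio_def abs_at_flip_at intro!: divide_left_mono)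
  next
    case False
    then have "\<not> ?T j \<le> ereal (flip_at j w $ j)"
      using that by (simp add: S_def flip_at_def neg)
    then show ?thesis
      using False by (simp add: loo_ratio_def abs_at_flip_at)
  qed
  then have "(\<Sum>j\<in>H. loo_ratio \<tau> H j (flip_at j w)) \<le> (\<Sum>j\<in>H. if j \<in> S then 1 / real (card S) else 0)"
    by (rule sum_mono)
  also have "\<dots> = (\<Sum>j\<in>S. 1 / real (card S))"
    by (intro sum.mono_neutral_cong_right) (auto simp: S_def)
  also have "\<dots> \<le> 1"
    by simp
  finally show ?thesis .
qed

section \<open>Measurability of the threshold, the leave-one-out ratios and the false discovery
  proportion\<close>

lemma real_card_Collect_measurable:
  fixes P :: "'p::finite \<Rightarrow> 'a \<Rightarrow> bool"
  assumes [measurable]: "\<And>k. Measurable.pred M (P k)"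
  shows "(\<lambda>x. real (card {k. P k x})) \<in> borel_measurable M"
proof -
  have "(\<lambda>x. real (card {k. P k x})) = (\<lambda>x. \<Sum>k\<in>UNIV. if P k x then 1 else 0)"
    by (auto simp: sum.If_cases)
  then show ?thesis
    by simp
qed

lemma knockoff_threshold_measurable [measurable]:
  "(\<lambda>w :: real ^ 'p::finite. knockoff_threshold \<tau> w) \<in> borel_measurable borel"
proof -
  have [measurable]: "(\<lambda>w :: real ^ 'p. real (card {k. w $ k \<le> - \<bar>w $ j\<bar>})) \<in> borel_measurable borel" for j
    by (rule real_card_Collect_measurable) measurable
  have [measurable]: "(\<lambda>w :: real ^ 'p. real (card {k. \<bar>w $ j\<bar> \<le> w $ k})) \<in> borel_measurable borel" for j
    by (rule real_card_Collect_measurable) measurable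
  \<comment> \<open>The candidate set depends on \<open>w\<close>; letting inadmissible indices
    contribute \<infinity> gives an infimum over a fixed finite index set.\<close>
  have eq: "knockoff_threshold \<tau> w =
      (INF j. if w $ j \<noteq> 0 \<and> fdp_estimate w \<bar>w $ j\<bar> \<le> \<tau> then ereal \<bar>w $ j\<bar> else \<infinity>)" for w :: "real ^ 'p"
    unfolding knockoff_threshold_def
    by (intro antisym INF_greatest Inf_greatest) (auto intro: Inf_lower INF_lower2)
  show ?thesis
    unfolding eq of_nat_max by measurable
qed

lemma vec_lambda_borel_measurable:
  assumes "\<And>i. (\<lambda>x. f x i) \<in> borel_measurable M"
  shows "(\<lambda>x. (\<chi> i. f x i) :: real ^ 'i::finite) \<in> borel_measurable M"
  using assms by (subst borel_measurable_euclidean_space) (auto simp: Basis_vec_def inner_axis)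

lemma loo_ratio_measurable [measurable]:
  "loo_ratio \<tau> H j \<in> borel_measurable (borel :: (real ^ 'p::finite) measure)"
proof -
  have [measurable]: "abs_at j \<in> borel_measurable (borel :: (real ^ 'p) measure)"
    unfolding abs_at_def by (intro vec_lambda_borel_measurable) simp
  have [measurable]: "(\<lambda>w :: real ^ 'p. real (card {k. k \<in> H - {j} \<and>
      ereal (w $ k) \<le> - knockoff_threshold \<tau> (abs_at j w)})) \<in> borel_measurable borel"
    by (rule real_card_Collect_measurable) measurable
  show ?thesis
    unfolding loo_ratio_def [abs_def] by measurable
qed

lemma fdp_knockoff_select_measurable [measurable]:
  "(\<lambda>w. fdp (knockoff_select \<tau> w) H) \<in> borel_measurable (borel :: (real ^ 'p::finite) measure)"
proof -
  have [measurable]: "(\<lambda>w :: real ^ 'p. real (card {k. knockoff_threshold \<tau> w \<le> ereal (w $ k) \<and> k \<in> H}))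
      \<in> borel_measurable borel"
    by (rule real_card_Collect_measurable) measurable
  have [measurable]: "(\<lambda>w :: real ^ 'p. real (card {k. knockoff_threshold \<tau> w \<le> ereal (w $ k)}))
      \<in> borel_measurable borel"
    by (rule real_card_Collect_measurable) measurable
  show ?thesis
    unfolding fdp_def knockoff_select_def of_nat_max Int_def mem_Collect_eq by measurable
qed

section \<open>Rotation of Gaussian noise and shifts of Laplace noise\<close>

lemma nn_integral_lborel_translate:
  fixes c :: "'a::euclidean_space"
  assumes [measurable]: "g \<in> borel_measurable borel"
  shows "(\<integral>\<^sup>+x. g (c + x) \<partial>lborel) = (\<integral>\<^sup>+x. g x \<partial>lborel)"
proof -
  have "(\<integral>\<^sup>+x. g x \<partial>lborel) = (\<integral>\<^sup>+x. g x \<partial>distr lborel borel ((+) c))"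
    by (simp only: lborel_distr_plus)
  then show ?thesis
    by (simp add: nn_integral_distr)
qed

text \<open>The library knows this only for index types of class \<open>wellorder\<close>. The argument below is the
  uniqueness of Haar measure, applied to Lebesgue measure and its image under \<open>Q\<close>, with the unit
  ball as the test set that fixes the constant.\<close>

lemma nn_integral_lborel_orthogonal_transformation:
  fixes Q :: "'a::euclidean_space \<Rightarrow> 'a"
  assumes Q: "orthogonal_transformation Q" and g [measurable]: "g \<in> borel_measurable borel"
  shows "(\<integral>\<^sup>+x. g (Q x) \<partial>lborel) = (\<integral>\<^sup>+x. g x \<partial>lborel)"
proof -
  define f :: "'a \<Rightarrow> ennreal" where "f = indicator (ball 0 1)"
  have [measurable]: "f \<in> borel_measurable borel"
    unfolding f_def by (rule borel_measurable_indicator) simp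
  have lin: "linear Q"
    using Q by (rule orthogonal_transformation_linear)
  then have [measurable]: "Q \<in> borel_measurable borel"
    by (intro borel_measurable_continuous_onI linear_continuous_on linear_conv_bounded_linear[THEN iffD1])
  \<comment> \<open>The ball is symmetric, so \<open>f (Q x - y)\<close> is, as a function of
    \<open>y\<close>, a translate of \<open>f\<close> and integrates to \<open>V\<close>.\<close>
  have fQ: "f (Q x) = f x" and fminus: "f (x - z) = f (- x + z)" for x z
    using norm_minus_commute[of x z]
    by (auto simp: f_def indicator_def orthogonal_transformation_norm[OF Q])
  define V where "V = (\<integral>\<^sup>+x. f x \<partial>lborel)"
  have "V = emeasure lborel (ball (0::'a) 1)"
    by (simp add: V_def f_def)
  moreover have "0 < emeasure lborel (ball (0::'a) 1)"
    using content_ball_pos[of 1 "0::'a"] emeasure_lborel_ball_finite[of "0::'a" 1]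
    by (simp add: emeasure_eq_ennreal_measure)
  ultimately have V: "V \<noteq> 0" "V \<noteq> \<infinity>"
    using emeasure_lborel_ball_finite[of "0::'a" 1] by auto
  have "V * (\<integral>\<^sup>+y. g y \<partial>lborel) = (\<integral>\<^sup>+x. f x * (\<integral>\<^sup>+y. g y \<partial>lborel) \<partial>lborel)"
    by (simp add: V_def nn_integral_multc)
  also have "\<dots> = (\<integral>\<^sup>+x. \<integral>\<^sup>+y. f (Q x) * g (Q x + y) \<partial>lborel \<partial>lborel)"
    by (simp add: fQ nn_integral_cmult nn_integral_lborel_translate)
  also have "\<dots> = (\<integral>\<^sup>+y. \<integral>\<^sup>+x. f (Q x) * g (Q x + y) \<partial>lborel \<partial>lborel)"
    by (rule lborel_pair.Fubini'[symmetric]) simp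
  also have "\<dots> = (\<integral>\<^sup>+y. \<integral>\<^sup>+x. f (Q x - y) * g (Q x) \<partial>lborel \<partial>lborel)"
  proof (rule nn_integral_cong)
    \<comment> \<open>Shifting \<open>x\<close> by a preimage of \<open>y\<close> moves
      \<open>y\<close> from the argument of \<open>g\<close> to that of \<open>f\<close>, so that
      integrating over \<open>y\<close> first now leaves the integral of
      \<open>g (Q x)\<close>.\<close>
    fix y
    obtain z where z: "Q z = y"
      using orthogonal_transformation_surj[OF Q] by (metis surjD)
    have "(\<integral>\<^sup>+x. f (Q x) * g (Q x + y) \<partial>lborel) =
        (\<integral>\<^sup>+x. f (Q (- z + x)) * g (Q (- z + x) + y) \<partial>lborel)"
      by (rule nn_integral_lborel_translate[symmetric]) simp
    also have "\<dots> = (\<integral>\<^sup>+x. f (Q x - y) * g (Q x) \<partial>lborel)"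
      by (simp add: linear_diff[OF lin] z)
    finally show "(\<integral>\<^sup>+x. f (Q x) * g (Q x + y) \<partial>lborel) = (\<integral>\<^sup>+x. f (Q x - y) * g (Q x) \<partial>lborel)" .
  qed
  also have "\<dots> = (\<integral>\<^sup>+x. \<integral>\<^sup>+y. f (Q x - y) * g (Q x) \<partial>lborel \<partial>lborel)"
    by (rule lborel_pair.Fubini') simp
  also have "\<dots> = (\<integral>\<^sup>+x. V * g (Q x) \<partial>lborel)"
  proof -
    have "(\<integral>\<^sup>+y. f (Q x - y) \<partial>lborel) = V" for x
      unfolding V_def fminus by (rule nn_integral_lborel_translate) simp
    then show ?thesis
      by (simp add: nn_integral_multc)
  qed
  also have "\<dots> = V * (\<integral>\<^sup>+x. g (Q x) \<partial>lborel)"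
    by (simp add: nn_integral_cmult)
  finally show ?thesis
    using V by (simp add: ennreal_mult_cancel_left)
qed

lemma nn_integral_isotropic_normal_orthogonal_transformation:
  fixes Q :: "real ^ 'n::finite \<Rightarrow> real ^ 'n"
  assumes Q: "orthogonal_transformation Q" and [measurable]: "g \<in> borel_measurable borel"
  shows "(\<integral>\<^sup>+x. g (Q x) \<partial>isotropic_normal \<sigma>) = (\<integral>\<^sup>+x. g x \<partial>isotropic_normal \<sigma>)"
proof -
  have [measurable]: "Q \<in> borel_measurable borel"
    using orthogonal_transformation_linear[OF Q]
    by (intro borel_measurable_continuous_onI linear_continuous_on linear_conv_bounded_linear[THEN iffD1])
  let ?\<phi> = "\<lambda>x :: real ^ 'n. ennreal (exp (- (norm x)\<^sup>2 / (2 * \<sigma>\<^sup>2)) / sqrt (2 * pi * \<sigma>\<^sup>2) ^ CARD('n))"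
  have "(\<integral>\<^sup>+x. g (Q x) \<partial>isotropic_normal \<sigma>) = (\<integral>\<^sup>+x. ?\<phi> (Q x) * g (Q x) \<partial>lborel)"
    by (simp add: isotropic_normal_def nn_integral_density orthogonal_transformation_norm[OF Q])
  also have "\<dots> = (\<integral>\<^sup>+x. ?\<phi> x * g x \<partial>lborel)"
    by (rule nn_integral_lborel_orthogonal_transformation[OF Q]) simp
  finally show ?thesis
    by (simp add: isotropic_normal_def nn_integral_density)
qed

text \<open>By the triangle inequality, a shift by \<open>c\<close> changes the density by a factor
  of at most \<open>exp (\<bar>c\<bar> / b)\<close>. The bound on \<open>c\<close> is stated without
  division, so that \<open>b = 0\<close> forces \<open>c = 0\<close> and the point mass is
  covered.\<close>

lemma nn_integral_laplace_translate_le: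
  assumes b: "b \<ge> 0" and "\<kappa> \<ge> 0" and c: "\<bar>c\<bar> \<le> b * \<kappa>" and [measurable]: "g \<in> borel_measurable borel"
  shows "(\<integral>\<^sup>+x. g x \<partial>laplace b) \<le> ennreal (exp \<kappa>) * (\<integral>\<^sup>+x. g (x - c) \<partial>laplace b)"
proof (cases "b = 0")
  case True
  moreover have "1 \<le> ennreal (exp \<kappa>)"
    using assms by simp
  ultimately show ?thesis
    using c mult_right_mono[of 1 "ennreal (exp \<kappa>)" "g 0"] by (simp add: laplace_def nn_integral_return)
next
  case False
  let ?\<phi> = "\<lambda>x. ennreal (exp (- \<bar>x\<bar> / b) / (2 * b))"
  have "(\<integral>\<^sup>+x. g x \<partial>laplace b) = (\<integral>\<^sup>+x. ?\<phi> x * g x \<partial>lborel)"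
    using False by (simp add: laplace_def nn_integral_density)
  also have "\<dots> = (\<integral>\<^sup>+x. ?\<phi> (- c + x) * g (- c + x) \<partial>lborel)"
    by (rule nn_integral_lborel_translate[symmetric]) simp
  also have "\<dots> \<le> (\<integral>\<^sup>+x. ennreal (exp \<kappa>) * (?\<phi> x * g (x - c)) \<partial>lborel)"
  proof (rule nn_integral_mono)
    fix x
    have "\<bar>x\<bar> \<le> \<bar>- c + x\<bar> + b * \<kappa>"
      using c by linarith
    then have "- \<bar>- c + x\<bar> / b \<le> \<kappa> + - \<bar>x\<bar> / b"
      using b False by (simp add: field_simps)
    then have "exp (- \<bar>- c + x\<bar> / b) / (2 * b) \<le> exp \<kappa> * (exp (- \<bar>x\<bar> / b) / (2 * b))"
      using b by (simp add: divide_right_mono flip: exp_add)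
    then have "?\<phi> (- c + x) \<le> ennreal (exp \<kappa>) * ?\<phi> x"
      by (simp add: ennreal_leI flip: ennreal_mult')
    then show "?\<phi> (- c + x) * g (- c + x) \<le> ennreal (exp \<kappa>) * (?\<phi> x * g (x - c))"
      unfolding mult.assoc[symmetric] by (auto intro: mult_right_mono)
  qed
  also have "\<dots> = ennreal (exp \<kappa>) * (\<integral>\<^sup>+x. g (x - c) \<partial>laplace b)"
    using False by (simp add: laplace_def nn_integral_density nn_integral_cmult)
  finally show ?thesis .
qed

text \<open>Fubini for the joint law. Only \<open>X\<close> is replaced by its law; \<open>Y\<close>
  stays a random variable on \<open>M\<close>, so that estimates for its expectations apply at each
  fixed value of \<open>X\<close>.\<close>

lemma nn_integral_indep_rv:
  assumes M: "prob_space M" and ind: "indep_rv M S X T Y"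
    and h [measurable]: "h \<in> borel_measurable (S \<Otimes>\<^sub>M T)"
  shows "(\<integral>\<^sup>+\<omega>. h (X \<omega>, Y \<omega>) \<partial>M) = (\<integral>\<^sup>+x. \<integral>\<^sup>+\<omega>. h (x, Y \<omega>) \<partial>M \<partial>distr M S X)"
proof -
  interpret prob_space M by fact
  have [measurable]: "X \<in> measurable M S" "Y \<in> measurable M T"
    and sets: "indep_set (sets (vimage_algebra (space M) X S)) (sets (vimage_algebra (space M) Y T))"
    using ind by (auto simp: indep_rv_def)
  interpret DX: prob_space "distr M S X" by (rule prob_space_distr) simp
  interpret DY: prob_space "distr M T Y" by (rule prob_space_distr) simp
  have eq: "distr M S X \<Otimes>\<^sub>M distr M T Y = distr M (S \<Otimes>\<^sub>M T) (\<lambda>\<omega>. (X \<omega>, Y \<omega>))"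
  proof (rule pair_measure_eqI)
    fix A B
    assume "A \<in> sets (distr M S X)" "B \<in> sets (distr M T Y)"
    then have [measurable]: "A \<in> sets S" "B \<in> sets T" by auto
    have "prob ((X -` A \<inter> space M) \<inter> (Y -` B \<inter> space M)) =
        prob (X -` A \<inter> space M) * prob (Y -` B \<inter> space M)"
      by (intro indep_setD[OF sets] in_vimage_algebra) auto
    moreover have "(\<lambda>\<omega>. (X \<omega>, Y \<omega>)) -` (A \<times> B) \<inter> space M = (X -` A \<inter> space M) \<inter> (Y -` B \<inter> space M)"
      by auto
    ultimately show "emeasure (distr M S X) A * emeasure (distr M T Y) B =
        emeasure (distr M (S \<Otimes>\<^sub>M T) (\<lambda>\<omega>. (X \<omega>, Y \<omega>))) (A \<times> B)"
      by (simp add: emeasure_distr emeasure_eq_measure ennreal_mult)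
  next
    show "sets (distr M S X \<Otimes>\<^sub>M distr M T Y) = sets (distr M (S \<Otimes>\<^sub>M T) (\<lambda>\<omega>. (X \<omega>, Y \<omega>)))"
      unfolding sets_distr by (rule sets_pair_measure_cong) simp_all
  qed (rule DX.sigma_finite_measure_axioms DY.sigma_finite_measure_axioms)+
  have "(\<integral>\<^sup>+\<omega>. h (X \<omega>, Y \<omega>) \<partial>M) = (\<integral>\<^sup>+z. h z \<partial>(distr M S X \<Otimes>\<^sub>M distr M T Y))"
    by (simp add: eq nn_integral_distr)
  also have "\<dots> = (\<integral>\<^sup>+x. \<integral>\<^sup>+y. h (x, y) \<partial>distr M T Y \<partial>distr M S X)"
    by (rule DY.nn_integral_fst[symmetric]) (simp cong: measurable_cong_sets)
  also have "\<dots> = (\<integral>\<^sup>+x. \<integral>\<^sup>+\<omega>. h (x, Y \<omega>) \<partial>M \<partial>distr M S X)"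
    by (intro nn_integral_cong) (simp add: nn_integral_distr)
  finally show ?thesis .
qed

text \<open>A bound for a single coordinate carries over to the product by integrating that
  coordinate first, with the others held fixed.\<close>

lemma (in product_sigma_finite) nn_integral_PiM_fun_upd_le:
  assumes I: "finite I" "i \<in> I"
    and T [measurable]: "T \<in> measurable (M i) (M i)"
    and le: "\<And>g. g \<in> borel_measurable (M i) \<Longrightarrow>
          (\<integral>\<^sup>+x. g x \<partial>M i) \<le> K * (\<integral>\<^sup>+x. g (T x) \<partial>M i)"
    and h: "h \<in> borel_measurable (Pi\<^sub>M I M)"
  shows "(\<integral>\<^sup>+f. h f \<partial>Pi\<^sub>M I M) \<le> K * (\<integral>\<^sup>+f. h (f(i := T (f i))) \<partial>Pi\<^sub>M I M)"
proof -
  define J where "J = I - {i}"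
  have J: "I = insert i J" "finite J" "i \<notin> J"
    using I by (auto simp: J_def)
  interpret Mi: sigma_finite_measure "M i"
    by (rule sigma_finite_measures)
  have [measurable]: "h \<in> borel_measurable (Pi\<^sub>M (insert i J) M)"
    using h by (simp add: J(1))
  have "(\<lambda>f. T (f i)) \<in> measurable (Pi\<^sub>M (insert i J) M) (M i)"
    by measurable
  then have "(\<lambda>f. f(i := T (f i))) \<in> measurable (Pi\<^sub>M (insert i J) M) (Pi\<^sub>M (insert i J) M)"
    by (intro measurable_fun_upd[where J = "insert i J"]) auto
  then have [measurable]: "(\<lambda>f. h (f(i := T (f i)))) \<in> borel_measurable (Pi\<^sub>M (insert i J) M)"
    by (rule measurable_compose) measurable
  have "(\<integral>\<^sup>+f. h f \<partial>Pi\<^sub>M I M) = (\<integral>\<^sup>+f. \<integral>\<^sup>+x. h (f(i := x)) \<partial>M i \<partial>Pi\<^sub>M J M)"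
    unfolding J(1) using J by (intro product_nn_integral_insert) auto
  also have "\<dots> \<le> (\<integral>\<^sup>+f. K * (\<integral>\<^sup>+x. h (f(i := T x)) \<partial>M i) \<partial>Pi\<^sub>M J M)"
  proof (intro nn_integral_mono le)
    fix f assume [measurable]: "f \<in> space (Pi\<^sub>M J M)"
    show "(\<lambda>x. h (f(i := x))) \<in> borel_measurable (M i)"
      using J by measurable
  qed
  also have "\<dots> = K * (\<integral>\<^sup>+f. \<integral>\<^sup>+x. h ((f(i := x))(i := T ((f(i := x)) i))) \<partial>M i \<partial>Pi\<^sub>M J M)"
    by (simp add: nn_integral_cmult)
  also have "\<dots> = K * (\<integral>\<^sup>+f. h (f(i := T (f i))) \<partial>Pi\<^sub>M I M)"
    unfolding J(1) using J by (subst product_nn_integral_insert) auto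
  finally show ?thesis .
qed

section \<open>Swaps and their effect on the Laplace noise\<close>

lemma swap_matrix_mult_vec: "swap_matrix i *v z = swap_on {i} z"
proof -
  have "(swap_matrix i *v z) $ a = z $ Transposition.transpose (Inl i) (Inr i) a" for a
    by (simp add: swap_matrix_def matrix_vector_mult_def if_distrib[where f = "\<lambda>x. x * _"] cong: if_cong)
  moreover have "swap_on {i} z $ a = z $ Transposition.transpose (Inl i) (Inr i) a" for a
    by (cases a) (auto simp: swap_on_def Transposition.transpose_def)
  ultimately show ?thesis
    by (simp add: vec_eq_iff)
qed

text \<open>The swap of the entries \<open>Inl i\<close> and \<open>Inr i\<close> is the reflection
  in the hyperplane orthogonal to this vector.\<close>

definition swap_dir :: "'p::finite \<Rightarrow> real ^ ('p + 'p)" where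
  "swap_dir i = axis (Inl i) 1 - axis (Inr i) 1"

lemma swap_on_singleton: "swap_on {i} z = z - (z $ Inl i - z $ Inr i) *\<^sub>R swap_dir i"
  by (auto simp: swap_on_def swap_dir_def axis_def vec_eq_iff split: sum.splits)

lemma swap_on_borel_measurable [measurable]: "swap_on {i} \<in> borel_measurable borel"
  unfolding swap_on_singleton[abs_def] by measurable

text \<open>The entries \<open>Inl i\<close> and \<open>Inr i\<close> have the same scale, so the
  product law is invariant under the swap. What remains is a shift of these two entries by
  \<open>c\<close> in opposite directions; each shift costs \<open>exp \<kappa>\<close>.\<close>

lemma laplace_noise_swap_le:
  fixes \<Delta> :: "'a \<Rightarrow> real ^ ('p::finite + 'p)" and b :: "'p \<Rightarrow> real"
  assumes M: "prob_space M"
    and ind: "prob_space.indep_vars M (\<lambda>_. borel) (\<lambda>j \<omega>. \<Delta> \<omega> $ j) UNIV"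
    and lap: "\<And>j. distr M borel (\<lambda>\<omega>. \<Delta> \<omega> $ j) = laplace (b (base_index j))"
    and b: "b i \<ge> 0" and \<kappa>: "\<kappa> \<ge> 0" and c: "\<bar>c\<bar> \<le> b i * \<kappa>"
    and h [measurable]: "h \<in> borel_measurable borel"
  shows "(\<integral>\<^sup>+\<omega>. h (\<Delta> \<omega>) \<partial>M) \<le>
    ennreal (exp (2 * \<kappa>)) * (\<integral>\<^sup>+\<omega>. h (swap_on {i} (\<Delta> \<omega>) - c *\<^sub>R swap_dir i) \<partial>M)"
proof -
  interpret prob_space M by fact
  define \<mu> where "\<mu> j = laplace (b (base_index j))" for j :: "'p + 'p"
  have rv [measurable]: "(\<lambda>\<omega>. \<Delta> \<omega> $ j) \<in> borel_measurable M" for j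
    using ind unfolding indep_vars_def by auto
  have \<mu>_distr: "\<mu> j = distr M borel (\<lambda>\<omega>. \<Delta> \<omega> $ j)" for j
    by (simp add: \<mu>_def lap)
  have \<mu>_prob: "prob_space (\<mu> j)" for j
    unfolding \<mu>_distr by (rule prob_space_distr) simp
  have [measurable_cong, simp]: "sets (\<mu> j) = sets borel" for j
    by (simp add: \<mu>_distr)
  interpret product_sigma_finite \<mu>
    unfolding product_sigma_finite_def using \<mu>_prob by (auto intro: prob_space_imp_sigma_finite)
  define L where "L = Pi\<^sub>M UNIV \<mu>"
  define vec where "vec f = (\<chi> j. f j)" for f :: "'p + 'p \<Rightarrow> real"
  have vec [measurable]: "vec \<in> borel_measurable L"
    unfolding vec_def L_def by (intro vec_lambda_borel_measurable) measurable
  have setsL: "sets L = sets (Pi\<^sub>M UNIV (\<lambda>_. borel))"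
    unfolding L_def by (rule sets_PiM_cong) auto
  have "distr M (\<Pi>\<^sub>M j\<in>UNIV. borel) (\<lambda>\<omega>. \<lambda>j\<in>UNIV. \<Delta> \<omega> $ j) = L"
    using ind unfolding L_def \<mu>_distr by (subst (asm) indep_vars_iff_distr_eq_PiM) auto
  then have L: "L = distr M (\<Pi>\<^sub>M j\<in>UNIV. borel) (\<lambda>\<omega> j. \<Delta> \<omega> $ j)"
    by (simp add: restrict_UNIV)
  have law: "(\<integral>\<^sup>+\<omega>. g (\<Delta> \<omega>) \<partial>M) = (\<integral>\<^sup>+f. g (vec f) \<partial>L)" if [measurable]: "g \<in> borel_measurable borel" for g
  proof -
    have "(\<lambda>f. g (vec f)) \<in> borel_measurable (\<Pi>\<^sub>M j\<in>UNIV. borel)"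
      using measurable_compose[OF vec that] measurable_cong_sets[OF setsL refl] by blast
    moreover have "(\<lambda>\<omega> j. \<Delta> \<omega> $ j) \<in> measurable M (\<Pi>\<^sub>M j\<in>UNIV. borel)"
      by (rule measurable_PiM_single') (auto simp: space_PiM)
    ultimately show ?thesis
      by (subst L, subst nn_integral_distr) (auto simp: vec_def)
  qed
  \<comment> \<open>Only the size of \<open>d\<close> is fixed, so this serves both for
    \<open>c\<close> at \<open>Inl i\<close> and for \<open>- c\<close> at
    \<open>Inr i\<close>.\<close>
  have shift: "(\<integral>\<^sup>+f. g f \<partial>L) \<le> ennreal (exp \<kappa>) * (\<integral>\<^sup>+f. g (f(j := f j - d)) \<partial>L)"
    if "base_index j = i" "\<bar>d\<bar> = \<bar>c\<bar>" "g \<in> borel_measurable L" for g j d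
    unfolding L_def
  proof (rule nn_integral_PiM_fun_upd_le)
    fix k :: "real \<Rightarrow> ennreal" assume "k \<in> borel_measurable (\<mu> j)"
    then have "k \<in> borel_measurable borel"
      by (simp cong: measurable_cong_sets)
    then show "(\<integral>\<^sup>+x. k x \<partial>\<mu> j) \<le> ennreal (exp \<kappa>) * (\<integral>\<^sup>+x. k (x - d) \<partial>\<mu> j)"
      unfolding \<mu>_def using that b \<kappa> c by (intro nn_integral_laplace_translate_le) auto
  qed (use that in \<open>auto simp: L_def\<close>)
  let ?\<tau> = "Transposition.transpose (Inl i) (Inr i)"
  have \<mu>\<tau>: "\<mu> (?\<tau> j) = \<mu> j" for j
    by (auto simp: \<mu>_def Transposition.transpose_def)
  \<comment> \<open>A permutation of the coordinates that preserves every marginal preserves the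
    product measure.\<close>
  have reindex: "distr L L (\<lambda>f j. f (?\<tau> j)) = L"
    using distr_PiM_reindex[of UNIV \<mu> ?\<tau> UNIV] \<mu>_prob by (simp add: \<mu>\<tau> L_def restrict_UNIV)
  have [measurable]: "(\<lambda>f. f(j := f j - d)) \<in> measurable L L" for j d
    unfolding L_def by (rule measurable_fun_upd[where J = UNIV]) auto
  have [measurable]: "(\<lambda>f j. f (?\<tau> j)) \<in> measurable L L"
    unfolding L_def by (rule measurable_PiM_single') (auto simp: space_PiM \<mu>_distr)
  have "(\<integral>\<^sup>+\<omega>. h (\<Delta> \<omega>) \<partial>M) = (\<integral>\<^sup>+f. h (vec f) \<partial>L)"
    by (rule law) simp
  also have "\<dots> \<le> ennreal (exp \<kappa>) * (\<integral>\<^sup>+f. h (vec (f(Inl i := f (Inl i) - c))) \<partial>L)"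
    by (rule shift) auto
  also have "\<dots> \<le> ennreal (exp \<kappa>) * (ennreal (exp \<kappa>) *
      (\<integral>\<^sup>+f. h (vec ((f(Inr i := f (Inr i) - - c))(Inl i := (f(Inr i := f (Inr i) - - c)) (Inl i) - c))) \<partial>L))"
    by (intro mult_left_mono shift[of "Inr i" "- c" "\<lambda>f. h (vec (f(Inl i := f (Inl i) - c)))"]) auto
  also have "\<dots> = ennreal (exp (2 * \<kappa>)) * (\<integral>\<^sup>+f. h (vec f - c *\<^sub>R swap_dir i) \<partial>L)"
  proof -
    have "vec ((f(Inr i := f (Inr i) - - c))(Inl i := (f(Inr i := f (Inr i) - - c)) (Inl i) - c)) =
        vec f - c *\<^sub>R swap_dir i" for f
      by (auto simp: vec_def swap_dir_def axis_def vec_eq_iff)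
    moreover have "ennreal (exp \<kappa>) * ennreal (exp \<kappa>) = ennreal (exp (2 * \<kappa>))"
      by (simp flip: ennreal_mult' exp_add)
    ultimately show ?thesis
      by (simp only: mult.assoc[symmetric])
  qed
  also have "(\<integral>\<^sup>+f. h (vec f - c *\<^sub>R swap_dir i) \<partial>L) = (\<integral>\<^sup>+f. h (vec (\<lambda>j. f (?\<tau> j)) - c *\<^sub>R swap_dir i) \<partial>L)"
    by (subst reindex[symmetric], subst nn_integral_distr) auto
  also have "\<dots> = (\<integral>\<^sup>+f. h (swap_on {i} (vec f) - c *\<^sub>R swap_dir i) \<partial>L)"
  proof -
    have "vec (\<lambda>j. f (?\<tau> j)) = swap_on {i} (vec f)" for f
      by (auto simp: vec_def swap_on_def vec_eq_iff Transposition.transpose_def split: sum.splits)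
    then show ?thesis by simp
  qed
  also have "\<dots> = (\<integral>\<^sup>+\<omega>. h (swap_on {i} (\<Delta> \<omega>) - c *\<^sub>R swap_dir i) \<partial>M)"
    by (rule law[symmetric]) simp
  finally show ?thesis .
qed

section \<open>The reflection that swaps a column with its knockoff\<close>

lemma inner_column: "(transpose A ** B) $ i $ j = column i A \<bullet> column j B"
  by (simp add: matrix_matrix_mult_def transpose_def column_def inner_vec_def)

text \<open>The columns of \<open>U\<close> are orthonormal and orthogonal to those of
  \<open>X\<close>, so the cross terms vanish. The part along \<open>X\<close> contributes
  \<open>gram X - 2 D + D I D\<close>, with \<open>D\<close> the diagonal matrix and
  \<open>I\<close> the inverse of \<open>gram X\<close>; the prescribed value of
  \<open>transpose C ** C\<close> cancels the excess.\<close>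

lemma knockoff_matrix_gram:
  fixes X Xt :: "real ^ 'p ^ 'n"
  assumes "invertible (gram X)" "knockoff_matrix X s Xt"
  shows "gram Xt = gram X"
proof -
  let ?D = "diag_mat s" and ?I = "matrix_inv (gram X)"
  obtain U :: "real ^ 'p ^ 'n" and C :: "real ^ 'p ^ 'p" where UU: "transpose U ** U = mat 1"
    and UX: "transpose U ** X = 0"
    and CC: "transpose C ** C = 2 *\<^sub>R ?D - ?D ** ?I ** ?D"
    and Xt: "Xt = X ** (mat 1 - ?I ** ?D) + U ** C"
    using assms(2) unfolding knockoff_matrix_def by blast
  have inv: "gram X ** ?I = mat 1 \<and> ?I ** gram X = mat 1"
    using assms(1) unfolding invertible_def matrix_inv_def by (rule someI2_ex) simp
  have "transpose ?I ** gram X = transpose (gram X ** ?I)"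
    by (simp add: matrix_transpose_mul transpose_gram)
  then have "transpose ?I ** gram X = mat 1"
    using inv by (simp add: transpose_mat)
  \<comment> \<open>A left inverse and a right inverse coincide, so the inverse of the symmetric
    \<open>gram X\<close> is symmetric.\<close>
  then have "transpose ?I ** (gram X ** ?I) = ?I"
    by (simp add: matrix_mul_assoc)
  then have tI: "transpose ?I = ?I"
    using inv by simp
  have tdiff: "transpose (A - B) = transpose A - transpose B" for A B :: "real ^ 'p ^ 'p"
    by (simp add: transpose_def vec_eq_iff)
  have tadd: "transpose (A + B) = transpose A + transpose B" for A B :: "real ^ 'p ^ 'n"
    by (simp add: transpose_def vec_eq_iff)
  have rdiff: "(A - B) ** C = A ** C - B ** C" for A B C :: "real ^ 'p ^ 'p"
    by (simp add: matrix_matrix_mult_def vec_eq_iff left_diff_distrib sum_subtractf)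
  have radd: "(A + B) ** C = A ** C + B ** C" for A B :: "real ^ 'n ^ 'p" and C :: "real ^ 'p ^ 'n"
    by (simp add: matrix_matrix_mult_def vec_eq_iff distrib_right sum.distrib)
  have "transpose U ** Xt = (transpose U ** X) ** (mat 1 - ?I ** ?D) + (transpose U ** U) ** C"
    by (simp only: Xt matrix_add_ldistrib matrix_mul_assoc)
  then have UXt: "transpose U ** Xt = C"
    by (simp add: UU UX matrix_mult_zero_left)
  have tXt: "transpose Xt = (mat 1 - ?D ** ?I) ** transpose X + transpose C ** transpose U"
    by (simp add: Xt tadd tdiff matrix_transpose_mul transpose_mat transpose_diag_mat tI)
  have "gram Xt = transpose Xt ** Xt"
    by (simp add: gram_def)
  also have "\<dots> = (mat 1 - ?D ** ?I) ** (transpose X ** Xt) + transpose C ** (transpose U ** Xt)"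
    by (simp only: tXt radd matrix_mul_assoc)
  also have "\<dots> = (mat 1 - ?D ** ?I) ** (gram X - ?D) + transpose C ** C"
    by (simp add: UXt knockoff_matrix_cross_gram[OF assms])
  also have "(mat 1 - ?D ** ?I) ** (gram X - ?D) =
      gram X - ?D - (?D ** (?I ** gram X) - ?D ** ?I ** ?D)"
    by (simp add: rdiff matrix_diff_ldistrib matrix_mul_assoc)
  also have "\<dots> + transpose C ** C = gram X"
    using inv by (simp add: CC scaleR_2)
  finally show ?thesis .
qed

lemma transpose_hcat_mult_nth:
  "(transpose (hcat X Xt) *v x) $ Inl k = column k X \<bullet> x"
  "(transpose (hcat X Xt) *v x) $ Inr k = column k Xt \<bullet> x"
  by (simp_all add: matrix_vector_mult_def transpose_def hcat_def column_def inner_vec_def)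

lemma swap_on_transpose_hcat:
  "swap_on {i} (transpose (hcat X Xt) *v x) =
     transpose (hcat X Xt) *v x - ((column i X - column i Xt) \<bullet> x) *\<^sub>R swap_dir i"
  by (simp add: swap_on_singleton transpose_hcat_mult_nth inner_diff_left
      del: transpose_matrix_vector)

text \<open>The blocks of the augmented Gram matrix differ only by \<open>diag_mat s\<close>, so
  \<open>v i\<close> is orthogonal to every column except the two with index \<open>i\<close>. The
  three facts give the image of \<open>v i\<close> under the transposed augmented design, the length
  needed for the reflection, and the displacement of the mean under the swap.\<close>

lemma knockoff_column_diff:
  fixes X Xt :: "real ^ 'p::finite ^ 'n"
  assumes X: "invertible (gram X)" "knockoff_matrix X s Xt"
  defines "v \<equiv> \<lambda>i. column i X - column i Xt"
  shows "transpose (hcat X Xt) *v v i = s $ i *\<^sub>R swap_dir i"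
    and "v i \<bullet> v i = 2 * s $ i"
    and "v i \<bullet> (X *v \<beta>) = s $ i * \<beta> $ i"
proof -
  have XX: "column k X \<bullet> column i X = gram X $ k $ i" for k
    by (simp add: gram_def inner_column)
  have tt: "column k Xt \<bullet> column i Xt = gram X $ k $ i" for k
    using knockoff_matrix_gram[OF X] by (metis gram_def inner_column)
  have Xt: "column k X \<bullet> column l Xt = gram X $ k $ l - diag_mat s $ k $ l" for k l
    using knockoff_matrix_cross_gram[OF X] by (metis inner_column vector_minus_component)
  have sym: "gram X $ k $ l = gram X $ l $ k" for k l
    by (simp add: gram_def inner_column inner_commute)
  have tX: "column k Xt \<bullet> column i X = gram X $ k $ i - diag_mat s $ k $ i" for k
    by (subst inner_commute) (auto simp: Xt sym[of i k] diag_mat_def)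
  show A: "transpose (hcat X Xt) *v v i = s $ i *\<^sub>R swap_dir i"
  proof (rule vec_eq_iff[THEN iffD2], rule allI)
    fix a show "(transpose (hcat X Xt) *v v i) $ a = (s $ i *\<^sub>R swap_dir i) $ a"
      by (cases a) (auto simp: transpose_hcat_mult_nth v_def inner_diff_right XX tt Xt tX
          diag_mat_def swap_dir_def axis_def simp del: transpose_matrix_vector)
  qed
  show "v i \<bullet> v i = 2 * s $ i"
    by (simp add: v_def inner_diff_left inner_diff_right XX tt Xt tX diag_mat_def)
  have "column k X \<bullet> v i = (if k = i then s $ i else 0)" for k
    by (auto simp: v_def inner_diff_right XX Xt diag_mat_def)
  then show "v i \<bullet> (X *v \<beta>) = s $ i * \<beta> $ i"
    by (simp add: matrix_mult_sum[of X \<beta>] inner_sum_right inner_commute[of "v i"]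
        scalar_mult_eq_scaleR if_distrib[where f = "\<lambda>x. _ * x"] mult.commute cong: if_cong)
qed

text \<open>The transposed augmented design maps \<open>v\<close> to a multiple of
  \<open>swap_dir i\<close>, so reflecting along \<open>v\<close> before applying it amounts to
  swapping afterwards.\<close>

lemma knockoff_reflection:
  fixes X Xt :: "real ^ 'p::finite ^ 'n::finite"
  assumes X: "invertible (gram X)" "knockoff_matrix X s Xt"
  obtains Q where "orthogonal_transformation Q"
    "\<And>x. swap_on {i} (transpose (hcat X Xt) *v x) = transpose (hcat X Xt) *v Q x"
proof
  define v where "v = column i X - column i Xt"
  \<comment> \<open>Since \<open>v \<bullet> v = 2 * s $ i\<close>, the coefficient is the usual
    \<open>2 * (v \<bullet> x) / (v \<bullet> v)\<close>. If \<open>s $ i = 0\<close>, then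
    \<open>v = 0\<close> and \<open>Q\<close> is the identity.\<close>
  define Q where "Q x = x - ((v \<bullet> x) / s $ i) *\<^sub>R v" for x
  have vv: "v \<bullet> v = 2 * s $ i"
    unfolding v_def by (rule knockoff_column_diff(2)[OF X])
  have Av: "transpose (hcat X Xt) *v v = s $ i *\<^sub>R swap_dir i"
    unfolding v_def by (rule knockoff_column_diff(1)[OF X])
  show "orthogonal_transformation Q"
    unfolding orthogonal_transformation_def
  proof (intro conjI allI)
    show "linear Q"
      by (rule linearI) (simp_all add: Q_def inner_add_right add_divide_distrib algebra_simps)
    fix x y show "Q x \<bullet> Q y = x \<bullet> y"
      using vv by (cases "s $ i = 0")
        (auto simp: Q_def inner_diff_left inner_diff_right inner_commute field_simps)
  qed
  fix x
  show "swap_on {i} (transpose (hcat X Xt) *v x) = transpose (hcat X Xt) *v Q x"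
  proof (cases "s $ i = 0")
    case True
    then have "v = 0" using vv by simp
    then show ?thesis
      by (simp add: swap_on_transpose_hcat Q_def flip: v_def del: transpose_matrix_vector)
  next
    case False
    then show ?thesis
      by (simp add: swap_on_transpose_hcat Q_def Av matrix_vector_mult_diff_distrib
          matrix_vector_mult_scaleR flip: v_def del: transpose_matrix_vector)
  qed
qed

section \<open>False discovery rate\<close>

text \<open>For a fixed value of \<open>y\<close>, the noise bound replaces \<Delta> by its swap
  shifted along \<open>swap_dir i\<close>, and this shift turns the mean into its swap. Replacing
  \<open>w\<close> by \<open>Q w\<close> then swaps the Gaussian part at no cost, and linearity of
  the swap collects the three parts into the swap of \<open>z\<close>.\<close>

lemma knockoff_swap_le:
  fixes X Xt :: "real ^ 'p::finite ^ 'n::finite"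
  assumes M: "prob_space M"
    and X: "invertible (gram X)" "knockoff_matrix X s Xt"
    and w [measurable]: "w \<in> borel_measurable M" and normal: "distr M borel w = isotropic_normal \<sigma>"
    and y: "\<And>\<omega>. y \<omega> = X *v \<beta> + w \<omega>"
    and s: "s $ i \<ge> 0" and \<epsilon>: "\<epsilon> > 0" and i: "\<bar>\<beta> $ i\<bar> \<le> \<delta> $ i"
    and \<Delta>: "prob_space.indep_vars M (\<lambda>_. borel) (\<lambda>j \<omega>. \<Delta> \<omega> $ j) UNIV"
      "\<And>j. distr M borel (\<lambda>\<omega>. \<Delta> \<omega> $ j) = laplace (2 * s $ base_index j * \<delta> $ base_index j / \<epsilon>)"
    and ind: "indep_rv M borel y borel \<Delta>"
    and h [measurable]: "h \<in> borel_measurable borel"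
  defines "z \<equiv> \<lambda>\<omega>. transpose (hcat X Xt) *v y \<omega> + \<Delta> \<omega>"
  shows "(\<integral>\<^sup>+\<omega>. h (z \<omega>) \<partial>M) \<le> ennreal (exp \<epsilon>) * (\<integral>\<^sup>+\<omega>. h (swap_on {i} (z \<omega>)) \<partial>M)"
proof -
  interpret prob_space M by fact
  define A where "A x = transpose (hcat X Xt) *v x" for x
  define c where "c = s $ i * \<beta> $ i"
  have y_meas [measurable]: "y \<in> borel_measurable M" and \<Delta>_meas [measurable]: "\<Delta> \<in> borel_measurable M"
    using ind by (auto simp: indep_rv_def)
  have A_add: "A (a + b) = A a + A b" for a b
    by (simp add: A_def matrix_vector_right_distrib del: transpose_matrix_vector)
  have A_cont: "continuous_on UNIV A"
    unfolding A_def by (intro linear_continuous_on matrix_vector_mul_bounded_linear)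
  then have [measurable]: "A \<in> borel_measurable borel"
    by (rule borel_measurable_continuous_onI)
  have swap_add: "swap_on {i} (a + b) = swap_on {i} a + swap_on {i} b" for a b
    by (simp add: swap_on_singleton algebra_simps)
  have A_mean: "A (X *v \<beta>) - c *\<^sub>R swap_dir i = swap_on {i} (A (X *v \<beta>))"
    unfolding A_def c_def swap_on_transpose_hcat knockoff_column_diff(3)[OF X] ..
  obtain Q where Q: "orthogonal_transformation Q" and AQ: "\<And>x. swap_on {i} (A x) = A (Q x)"
    unfolding A_def using knockoff_reflection[OF X] by blast
  have noise: "(\<integral>\<^sup>+\<omega>. g (\<Delta> \<omega>) \<partial>M) \<le>
      ennreal (exp \<epsilon>) * (\<integral>\<^sup>+\<omega>. g (swap_on {i} (\<Delta> \<omega>) - c *\<^sub>R swap_dir i) \<partial>M)"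
    if "g \<in> borel_measurable borel" for g
  proof -
    have "\<bar>c\<bar> \<le> s $ i * \<delta> $ i"
      using s i by (simp add: c_def abs_mult mult_left_mono)
    \<comment> \<open>The factor 2 in the Laplace scale leaves \<open>\<epsilon> / 2\<close> for
      each of the two shifted entries, hence \<open>exp \<epsilon>\<close> in total.\<close>
    then have "\<bar>c\<bar> \<le> 2 * s $ i * \<delta> $ i / \<epsilon> * (\<epsilon> / 2)"
      using \<epsilon> by simp
    moreover have "0 \<le> 2 * s $ i * \<delta> $ i / \<epsilon>"
      using s i \<epsilon> by auto
    ultimately show ?thesis
      using laplace_noise_swap_le[OF M \<Delta>(1), of "\<lambda>k. 2 * s $ k * \<delta> $ k / \<epsilon>" i "\<epsilon> / 2" c g] \<epsilon> \<Delta>(2) that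
      by simp
  qed
  \<comment> \<open>With \<Delta> integrated out and the mean already swapped, only the Gaussian
    noise is left as argument, so its rotation invariance applies to \<open>k\<close>.\<close>
  define k where "k x = (\<integral>\<^sup>+\<omega>. h (swap_on {i} (A (X *v \<beta>)) + A x + swap_on {i} (\<Delta> \<omega>)) \<partial>M)" for x
  have k [measurable]: "k \<in> borel_measurable borel"
    unfolding k_def by measurable
  have "(\<integral>\<^sup>+\<omega>. h (z \<omega>) \<partial>M) = (\<integral>\<^sup>+x. \<integral>\<^sup>+\<omega>. h (A x + \<Delta> \<omega>) \<partial>M \<partial>distr M borel y)"
    using nn_integral_indep_rv[OF M ind, of "\<lambda>(x, d). h (A x + d)"]
    by (simp add: z_def flip: A_def del: transpose_matrix_vector)
  also have "\<dots> \<le> (\<integral>\<^sup>+x. ennreal (exp \<epsilon>) *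
      (\<integral>\<^sup>+\<omega>. h (A x + (swap_on {i} (\<Delta> \<omega>) - c *\<^sub>R swap_dir i)) \<partial>M) \<partial>distr M borel y)"
    by (intro nn_integral_mono noise) simp
  also have "\<dots> = ennreal (exp \<epsilon>) *
      (\<integral>\<^sup>+x. \<integral>\<^sup>+\<omega>. h (A x + (swap_on {i} (\<Delta> \<omega>) - c *\<^sub>R swap_dir i)) \<partial>M \<partial>distr M borel y)"
    by (rule nn_integral_cmult) measurable
  \<comment> \<open>The outer integral returns to \<open>M\<close> with its own sample point
    \<open>\<omega>'\<close>, which keeps \<open>w\<close> decoupled from \<Delta> at
    \<open>\<omega>\<close>.\<close>
  also have "(\<integral>\<^sup>+x. \<integral>\<^sup>+\<omega>. h (A x + (swap_on {i} (\<Delta> \<omega>) - c *\<^sub>R swap_dir i)) \<partial>M \<partial>distr M borel y) =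
      (\<integral>\<^sup>+\<omega>'. k (w \<omega>') \<partial>M)"
  proof (subst nn_integral_distr)
    have eq: "A (y \<omega>') + (d - c *\<^sub>R swap_dir i) = swap_on {i} (A (X *v \<beta>)) + A (w \<omega>') + d" for \<omega>' d
      by (simp add: y A_add flip: A_mean)
    then show "(\<integral>\<^sup>+\<omega>'. \<integral>\<^sup>+\<omega>. h (A (y \<omega>') + (swap_on {i} (\<Delta> \<omega>) - c *\<^sub>R swap_dir i)) \<partial>M \<partial>M) =
        (\<integral>\<^sup>+\<omega>'. k (w \<omega>') \<partial>M)"
      by (simp only: k_def eq)
  qed measurable
  also have "\<dots> = (\<integral>\<^sup>+\<omega>'. k (Q (w \<omega>')) \<partial>M)"
  proof -
    have [measurable]: "Q \<in> borel_measurable borel"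
      using orthogonal_transformation_linear[OF Q]
      by (intro borel_measurable_continuous_onI linear_continuous_on linear_conv_bounded_linear[THEN iffD1])
    show ?thesis
      using nn_integral_isotropic_normal_orthogonal_transformation[OF Q k, of \<sigma>]
      by (simp add: nn_integral_distr flip: normal)
  qed
  also have "\<dots> = (\<integral>\<^sup>+x. \<integral>\<^sup>+\<omega>. h (swap_on {i} (A x + \<Delta> \<omega>)) \<partial>M \<partial>distr M borel y)"
  proof (subst nn_integral_distr)
    have "swap_on {i} (A (X *v \<beta>)) + A (Q (w \<omega>')) + swap_on {i} d = swap_on {i} (A (y \<omega>') + d)" for \<omega>' d
      by (simp only: swap_add y A_add AQ)
    then show "(\<integral>\<^sup>+\<omega>'. k (Q (w \<omega>')) \<partial>M) = (\<integral>\<^sup>+\<omega>'. \<integral>\<^sup>+\<omega>. h (swap_on {i} (A (y \<omega>') + \<Delta> \<omega>)) \<partial>M \<partial>M)"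
      by (simp add: k_def)
  qed measurable
  also have "\<dots> = (\<integral>\<^sup>+\<omega>. h (swap_on {i} (z \<omega>)) \<partial>M)"
    using nn_integral_indep_rv[OF M ind, of "\<lambda>(x, d). h (swap_on {i} (A x + d))"]
    by (simp add: z_def flip: A_def del: transpose_matrix_vector)
  finally show ?thesis .
qed

theorem theorem3:
  fixes M :: "'a measure"
    and X Xt :: "real ^ 'p::finite ^ 'n::finite"
    and \<beta> s \<delta> :: "real ^ 'p"
    and \<sigma> \<epsilon> q :: real
    and w y :: "'a \<Rightarrow> real ^ 'n"
    and \<Delta> :: "'a \<Rightarrow> real ^ ('p + 'p)"
    and \<E> :: "real ^ ('p + 'p) ^ ('p + 'p) \<Rightarrow> real ^ ('p + 'p) \<Rightarrow> real ^ ('p + 'p)"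
    and W :: "real ^ ('p + 'p) \<Rightarrow> real ^ 'p"
  assumes "prob_space M"
    and "CARD('n) \<ge> 2 * CARD('p)"
    and "\<forall>i. norm (column i X) = 1"
    and "invertible (gram X)"
    and "\<sigma> > 0"
    and "w \<in> borel_measurable M"
    and "distr M borel w = isotropic_normal \<sigma>"
    and "\<forall>\<omega>. y \<omega> = X *v \<beta> + w \<omega>"
    and "\<forall>i. s $ i \<ge> 0"
    and "psd (2 *\<^sub>R gram X - diag_mat s)"
    and "knockoff_matrix X s Xt"
    and "\<epsilon> > 0"
    and "0 \<le> q" and "q \<le> 1"
    and "\<forall>i. \<delta> $ i \<ge> 0"
    and "prob_space.indep_vars M (\<lambda>_. borel) (\<lambda>j \<omega>. \<Delta> \<omega> $ j) UNIV"
    and "\<forall>j. distr M borel (\<lambda>\<omega>. \<Delta> \<omega> $ j) =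
               laplace (2 * s $ base_index j * \<delta> $ base_index j / \<epsilon>)"
    and "indep_rv M borel y borel \<Delta>"
    and "\<E> (gram (hcat X Xt)) \<in> borel_measurable borel"
    and "swap_equivariant (\<E> (gram (hcat X Xt)))"
    and "W \<in> borel_measurable borel"
    and "antisymmetric_statistics W"
  shows "prob_space.expectation M
           (\<lambda>\<omega>. fdp (knockoff_select (q / exp \<epsilon>)
                        (W (\<E> (gram (hcat X Xt)) (transpose (hcat X Xt) *v y \<omega> + \<Delta> \<omega>))))
                    {i. \<bar>\<beta> $ i\<bar> \<le> \<delta> $ i}) \<le> q"
proof -
  interpret prob_space M by fact
  define H where "H = {i. \<bar>\<beta> $ i\<bar> \<le> \<delta> $ i}"
  define \<tau> where "\<tau> = q / exp \<epsilon>"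
  define z where "z \<omega> = transpose (hcat X Xt) *v y \<omega> + \<Delta> \<omega>" for \<omega>
  define \<phi> where "\<phi> u = W (\<E> (gram (hcat X Xt)) u)" for u
  note [measurable] = \<open>\<E> (gram (hcat X Xt)) \<in> borel_measurable borel\<close> \<open>W \<in> borel_measurable borel\<close>
  have [measurable]: "y \<in> borel_measurable M" "\<Delta> \<in> borel_measurable M"
    using \<open>indep_rv M borel y borel \<Delta>\<close> by (auto simp: indep_rv_def)
  have "continuous_on UNIV (\<lambda>x. transpose (hcat X Xt) *v x)"
    by (intro linear_continuous_on matrix_vector_mul_bounded_linear)
  then have [measurable]: "(\<lambda>x. transpose (hcat X Xt) *v x) \<in> borel_measurable borel"
    by (rule borel_measurable_continuous_onI)
  have [measurable]: "z \<in> borel_measurable M"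
    unfolding z_def by measurable
  have [measurable]: "\<phi> \<in> borel_measurable borel"
    unfolding \<phi>_def by measurable
  have \<phi>_swap: "\<phi> (swap_on {i} u) = flip_at i (\<phi> u)" for i u
  proof -
    have "\<E> (gram (hcat X Xt)) (swap_on {i} u) = swap_on {i} (\<E> (gram (hcat X Xt)) u)"
      using \<open>swap_equivariant (\<E> (gram (hcat X Xt)))\<close>
      by (simp add: swap_equivariant_def swap_matrix_mult_vec)
    then show ?thesis
      using \<open>antisymmetric_statistics W\<close>
      by (simp add: \<phi>_def antisymmetric_statistics_def flip_at_def)
  qed
  have \<tau>: "\<tau> \<ge> 0"
    using \<open>0 \<le> q\<close> by (simp add: \<tau>_def)
  \<comment> \<open>The swap bound is applied to the composition of the ratio with \<phi>, where
    swapping the argument becomes a sign flip of the statistic.\<close>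
  have swap: "(\<integral>\<^sup>+\<omega>. ennreal (loo_ratio \<tau> H i (\<phi> (z \<omega>))) \<partial>M) \<le>
      ennreal (exp \<epsilon>) * (\<integral>\<^sup>+\<omega>. ennreal (loo_ratio \<tau> H i (flip_at i (\<phi> (z \<omega>)))) \<partial>M)" if "i \<in> H" for i
    unfolding z_def \<phi>_swap[symmetric]
    by (rule knockoff_swap_le[OF assms(1) assms(4) assms(11) assms(6,7) assms(8)[rule_format]
          assms(9)[rule_format] assms(12) _ assms(16) assms(17)[rule_format] assms(18)])
      (use that in \<open>simp_all add: H_def\<close>)
  have flip_meas: "(\<lambda>\<omega>. loo_ratio \<tau> H i (flip_at i (\<phi> (z \<omega>)))) \<in> borel_measurable M" for i
    unfolding \<phi>_swap[symmetric] by measurable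
  have "(\<integral>\<^sup>+\<omega>. ennreal (fdp (knockoff_select \<tau> (\<phi> (z \<omega>))) H) \<partial>M) \<le>
      (\<integral>\<^sup>+\<omega>. ennreal \<tau> * (\<Sum>i\<in>H. ennreal (loo_ratio \<tau> H i (\<phi> (z \<omega>)))) \<partial>M)"
  proof (rule nn_integral_mono)
    fix \<omega>
    have "ennreal (fdp (knockoff_select \<tau> (\<phi> (z \<omega>))) H) \<le> ennreal (\<tau> * (\<Sum>i\<in>H. loo_ratio \<tau> H i (\<phi> (z \<omega>))))"
      by (intro ennreal_leI fdp_le_sum_loo_ratio)
    then show "ennreal (fdp (knockoff_select \<tau> (\<phi> (z \<omega>))) H) \<le>
        ennreal \<tau> * (\<Sum>i\<in>H. ennreal (loo_ratio \<tau> H i (\<phi> (z \<omega>))))"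
      using \<tau> by (simp add: ennreal_mult' sum_ennreal loo_ratio_nonneg)
  qed
  also have "\<dots> = ennreal \<tau> * (\<Sum>i\<in>H. \<integral>\<^sup>+\<omega>. ennreal (loo_ratio \<tau> H i (\<phi> (z \<omega>))) \<partial>M)"
    by (simp add: nn_integral_cmult nn_integral_sum)
  also have "\<dots> \<le> ennreal \<tau> * (\<Sum>i\<in>H. ennreal (exp \<epsilon>) *
      (\<integral>\<^sup>+\<omega>. ennreal (loo_ratio \<tau> H i (flip_at i (\<phi> (z \<omega>)))) \<partial>M))"
    by (intro mult_left_mono sum_mono swap) auto
  \<comment> \<open>The target level \<open>q / exp \<epsilon>\<close> absorbs the cost of the
    flips. The sum returns inside the integral because its bound by 1 holds pointwise, not term by
    term.\<close>
  also have "\<dots> = ennreal q * (\<integral>\<^sup>+\<omega>. (\<Sum>i\<in>H. ennreal (loo_ratio \<tau> H i (flip_at i (\<phi> (z \<omega>))))) \<partial>M)"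
  proof -
    have "ennreal \<tau> * ennreal (exp \<epsilon>) = ennreal q"
      using \<tau> by (simp add: \<tau>_def flip: ennreal_mult')
    then show ?thesis
      using flip_meas by (simp add: nn_integral_sum mult.assoc[symmetric] flip: sum_distrib_left)
  qed
  also have "\<dots> \<le> ennreal q * (\<integral>\<^sup>+\<omega>. 1 \<partial>M)"
    using sum_loo_ratio_flip_at_le[of \<tau> H]
    by (intro mult_left_mono nn_integral_mono) (auto simp: sum_ennreal loo_ratio_nonneg)
  also have "\<dots> = ennreal q"
    by (simp add: emeasure_space_1)
  finally have nn: "(\<integral>\<^sup>+\<omega>. ennreal (fdp (knockoff_select \<tau> (\<phi> (z \<omega>))) H) \<partial>M) \<le> ennreal q" .
  have "(\<integral>\<omega>. fdp (knockoff_select \<tau> (\<phi> (z \<omega>))) H \<partial>M) =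
      enn2real (\<integral>\<^sup>+\<omega>. ennreal (fdp (knockoff_select \<tau> (\<phi> (z \<omega>))) H) \<partial>M)"
  proof (rule integral_eq_nn_integral)
    show "(\<lambda>\<omega>. fdp (knockoff_select \<tau> (\<phi> (z \<omega>))) H) \<in> borel_measurable M"
      by measurable
  qed (simp add: fdp_def)
  also have "\<dots> \<le> q"
    using nn \<open>0 \<le> q\<close> by (rule enn2real_leI[rotated])
  finally show ?thesis
    by (simp only: H_def \<tau>_def z_def \<phi>_def)
qed

end
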